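(* Let $x_1,x_2,x_3,x_4\in\mathbb R^3$ be the vertices of a semiregular tetrahedron, i.e. a tetrahedron whose opposite edges are equal: $r_{23}=r_{14}$, $r_{13}=r_{24}$, $r_{12}=r_{34}$. Then both Four Points inequalities hold: for $$\delta_l=\frac{d_3(r_{ij},r_{ik},r_{jk})}{r_{ij}r_{ik}r_{jk}}\ \ (l=1,\dots,4)\quad\text{(weak version)}\qquad\text{and for}\qquad \delta_l=1\ \ (l=1,\dots,4)\quad\text{(strong version)}$$ one has $$\Re(D_4)-\Bigl(4+\tfrac34\Bigr)\cdot 288V^2\ \ge\ 64\prod_{1\le i<j\le 4}r_{ij}+\sum_{l=1}^4\Bigl(4+\tfrac14\delta_l\Bigr)r_{il}r_{jl}r_{kl}\,d_3(r_{ij},r_{ik},r_{jk}),$$ where for each $l$ one writes $\{1,2,3,4\}\setminus\{l\}=\{i<j<k\}$.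
   Context: Put $d_3(a,b,c)=(a+b-c)(b+c-a)(c+a-b)$. For distinct points $x_1,\dots,x_4\in\mathbb R^3$ let $r_{ij}=|x_i-x_j|$, and let $V$ be the volume of the tetrahedron with these vertices ($V=0$ if coplanar). The (non-normalized) Atiyah determinant $D_4\in\mathbb C$ is defined as follows. Identify $S^2$ with $\mathbb{CP}^1=\mathbb C\cup\{\infty\}$ by stereographic projection, so that the antipode of $t$ is $-1/\bar t$. For $i\ne j$ let $t_{ij}$ be the point corresponding to the unit vector $(x_j-x_i)/r_{ij}$. For each pair $i<j$ choose a unit vector $(\alpha,\beta)\in\mathbb C^2$ such that $\ell_{ij}(t)=\alpha t+\beta$ has root $t_{ij}$ (with $\alpha=0$ if $t_{ij}=\infty$), and put $\ell_{ji}(t)=-\bar\beta t+\bar\alpha$ (which has root $t_{ji}$). Let $p_i(t)=\prod_{j\ne i}\ell_{ij}(t)=\sum_{j=1}^4 m_{ij}t^{j-1}$ and $D_4=64\prod_{1\le i<j\le4}r_{ij}\cdot\det(m_{ij})$; this does not depend on the choices. Known fact (Eastwood–Norbury): $$\Re(D_4)=64\prod_{i<j}r_{ij}-4d_3(r_{12}r_{34},r_{13}r_{24},r_{14}r_{23})+A_4+288V^2,$$ $$A_4=\sum_{l=1}^4\Bigl(\sum_{i\ne l}r_{li}\bigl((r_{lj}+r_{lk})^2-r_{jk}^2\bigr)\Bigr)d_3(r_{ij},r_{ik},r_{jk}),\qquad \{j,k\}=\{1,2,3,4\}\setminus\{l,i\}.$$ *)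

theory Defs
  imports "HOL-Analysis.Analysis" "Jordan_Normal_Form.Determinant"
begin

no_notation Matrix.vec_index (infixl "$" 100)

definition d3 :: "real \<Rightarrow> real \<Rightarrow> real \<Rightarrow> real" where
  "d3 a b c = (a + b - c) * (b + c - a) * (c + a - b)"

text \<open>Points of \<open>\<real>\<^sup>3\<close> are \<open>x 1, \<dots>, x 4\<close> for a map \<open>x\<close> on the naturals; its values outside
  \<open>{1..4}\<close> are never used.\<close>

text \<open>Stereographic projection from the north pole, \<open>None\<close> being the point at infinity. It takes
  the antipode of \<open>t\<close> to \<open>- 1 / cnj t\<close>.\<close>

definition stereo :: "real^3 \<Rightarrow> complex option" where
  "stereo u = (if u $ 3 = 1 then None
     else Some (Complex (u $ 1) (u $ 2) / of_real (1 - u $ 3)))"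

definition dir_point :: "(nat \<Rightarrow> real^3) \<Rightarrow> nat \<Rightarrow> nat \<Rightarrow> complex option" where
  "dir_point x i j = stereo ((x j - x i) /\<^sub>R dist (x i) (x j))"

text \<open>The linear form \<open>a * t + b\<close> has the given point of the Riemann sphere as its root.\<close>

definition has_root :: "complex \<Rightarrow> complex \<Rightarrow> complex option \<Rightarrow> bool" where
  "has_root a b p = (case p of None \<Rightarrow> a = 0 | Some t \<Rightarrow> a * t + b = 0)"

text \<open>\<open>\<alpha> i j\<close>, \<open>\<beta> i j\<close> are the coefficients chosen for the pair \<open>i < j\<close>.\<close>

definition admissible_choice ::
    "(nat \<Rightarrow> real^3) \<Rightarrow> (nat \<Rightarrow> nat \<Rightarrow> complex) \<Rightarrow> (nat \<Rightarrow> nat \<Rightarrow> complex) \<Rightarrow> bool" where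
  "admissible_choice x \<alpha> \<beta> \<longleftrightarrow>
     (\<forall>i\<in>{1..4}. \<forall>j\<in>{1..4}. i < j \<longrightarrow>
        (cmod (\<alpha> i j))\<^sup>2 + (cmod (\<beta> i j))\<^sup>2 = 1 \<and>
        has_root (\<alpha> i j) (\<beta> i j) (dir_point x i j))"

definition lin_form ::
    "(nat \<Rightarrow> nat \<Rightarrow> complex) \<Rightarrow> (nat \<Rightarrow> nat \<Rightarrow> complex) \<Rightarrow> nat \<Rightarrow> nat \<Rightarrow> complex poly" where
  "lin_form \<alpha> \<beta> i j =
     (if i < j then [:\<beta> i j, \<alpha> i j:] else [:cnj (\<alpha> j i), - cnj (\<beta> j i):])"

definition atiyah_poly ::
    "(nat \<Rightarrow> nat \<Rightarrow> complex) \<Rightarrow> (nat \<Rightarrow> nat \<Rightarrow> complex) \<Rightarrow> nat \<Rightarrow> complex poly" where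
  "atiyah_poly \<alpha> \<beta> i = (\<Prod>j\<in>{1..4} - {i}. lin_form \<alpha> \<beta> i j)"

definition edge_prod :: "(nat \<Rightarrow> real^3) \<Rightarrow> real" where
  "edge_prod x = (\<Prod>(i, j)\<in>{(i, j). 1 \<le> i \<and> i < j \<and> j \<le> 4}. dist (x i) (x j))"

text \<open>Rows and columns of a matrix are numbered from 0 here, so the entry \<open>(i, j)\<close> is the
  coefficient of \<open>t ^ j\<close> in the polynomial of the point \<open>x (i + 1)\<close>.\<close>

definition atiyah_det ::
    "(nat \<Rightarrow> real^3) \<Rightarrow> (nat \<Rightarrow> nat \<Rightarrow> complex) \<Rightarrow> (nat \<Rightarrow> nat \<Rightarrow> complex) \<Rightarrow> complex" where
  "atiyah_det x \<alpha> \<beta> = 64 * of_real (edge_prod x) *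
     Determinant.det (Matrix.mat 4 4 (\<lambda>(i, j). Polynomial.coeff (atiyah_poly \<alpha> \<beta> (i + 1)) j))"

definition tetra_volume :: "(nat \<Rightarrow> real^3) \<Rightarrow> real" where
  "tetra_volume x = measure lborel (convex hull (x ` {1..4}))"

text \<open>The vertices \<open>i < j < k\<close> of the face opposite to the vertex \<open>l\<close>.\<close>

definition opposite_face :: "nat \<Rightarrow> nat \<times> nat \<times> nat" where
  "opposite_face l = (THE (i, j, k). {1..4} - {l} = {i, j, k} \<and> i < j \<and> j < k)"

definition face_d3 :: "(nat \<Rightarrow> real^3) \<Rightarrow> nat \<Rightarrow> real" where
  "face_d3 x l = (case opposite_face l of (i, j, k) \<Rightarrow>
     d3 (dist (x i) (x j)) (dist (x i) (x k)) (dist (x j) (x k)))"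

definition face_prod :: "(nat \<Rightarrow> real^3) \<Rightarrow> nat \<Rightarrow> real" where
  "face_prod x l = (case opposite_face l of (i, j, k) \<Rightarrow>
     dist (x i) (x j) * dist (x i) (x k) * dist (x j) (x k))"

definition vertex_prod :: "(nat \<Rightarrow> real^3) \<Rightarrow> nat \<Rightarrow> real" where
  "vertex_prod x l = (case opposite_face l of (i, j, k) \<Rightarrow>
     dist (x i) (x l) * dist (x j) (x l) * dist (x k) (x l))"

definition four_points_inequality ::
    "(nat \<Rightarrow> real^3) \<Rightarrow> complex \<Rightarrow> (nat \<Rightarrow> real) \<Rightarrow> bool" where
  "four_points_inequality x D \<delta> \<longleftrightarrow>
     Re D - (4 + 3/4) * (288 * (tetra_volume x)\<^sup>2)
       \<ge> 64 * edge_prod x + (\<Sum>l = 1..4. (4 + 1/4 * \<delta> l) * vertex_prod x l * face_d3 x l)"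

definition weak_delta :: "(nat \<Rightarrow> real^3) \<Rightarrow> nat \<Rightarrow> real" where
  "weak_delta x l = face_d3 x l / face_prod x l"

definition semiregular :: "(nat \<Rightarrow> real^3) \<Rightarrow> bool" where
  "semiregular x \<longleftrightarrow>
     dist (x 2) (x 3) = dist (x 1) (x 4) \<and>
     dist (x 1) (x 3) = dist (x 2) (x 4) \<and>
     dist (x 1) (x 2) = dist (x 3) (x 4)"

lemma opposite_face:
  "opposite_face 1 = (2, 3, 4)" "opposite_face 2 = (1, 3, 4)"
  "opposite_face 3 = (1, 2, 4)" "opposite_face 4 = (1, 2, 3)"
proof -
  have key: "opposite_face l = (a, b, c)"
    if *: "{1..4} - {l} = {a, b, c}" "a < b" "b < c" for l a b c :: nat
    unfolding opposite_face_def
  proof (rule the_equality)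
    show "case (a, b, c) of (i, j, k) \<Rightarrow> {1..4} - {l} = {i, j, k} \<and> i < j \<and> j < k"
      using * by simp
  next
    fix p :: "nat \<times> nat \<times> nat"
    assume p: "case p of (i, j, k) \<Rightarrow> {1..4} - {l} = {i, j, k} \<and> i < j \<and> j < k"
    obtain i j k where [simp]: "p = (i, j, k)" by (cases p)
    have eq: "{a, b, c} = {i, j, k}" and lt: "i < j" "j < k" using p * by auto
    have sl: "sorted_list_of_set {u, v, w} = [u, v, w]" if "u < v" "v < w" for u v w :: nat
    proof -
      have "sorted_list_of_set (set [u, v, w]) = [u, v, w]"
        using that by (intro sorted_list_of_set.idem_if_sorted_distinct) simp_all
      then show ?thesis by simp
    qed
    have "[a, b, c] = [i, j, k]"
      using sl[OF *(2,3)] sl[OF lt] eq by metis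
    then show "p = (a, b, c)" by simp
  qed
  show "opposite_face 1 = (2, 3, 4)" "opposite_face 2 = (1, 3, 4)"
    "opposite_face 3 = (1, 2, 4)" "opposite_face 4 = (1, 2, 3)"
    by (rule key; simp add: set_eq_iff; presburger)+
qed

lemma ex_unit_form: "\<exists>a b. (cmod a)\<^sup>2 + (cmod b)\<^sup>2 = 1 \<and> has_root a b p"
proof (cases p)
  case None
  then show ?thesis by (intro exI[of _ 0] exI[of _ 1]) (simp add: has_root_def)
next
  case (Some t)
  define n where "n = sqrt (1 + (cmod t)\<^sup>2)"
  have n: "n\<^sup>2 = 1 + (cmod t)\<^sup>2" "n > 0" by (auto simp: n_def add_pos_nonneg)
  have "(cmod (1 / of_real n))\<^sup>2 + (cmod (- t / of_real n))\<^sup>2 = (1 + (cmod t)\<^sup>2) / n\<^sup>2"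
    by (simp add: norm_divide power_divide add_divide_distrib)
  also have "\<dots> = 1" using n by (metis divide_self less_irrefl power_not_zero)
  finally show ?thesis using Some
    by (intro exI[of _ "1 / of_real n"] exI[of _ "- t / of_real n"]) (simp add: has_root_def)
qed

lemma ex_admissible_choice: "\<exists>\<alpha> \<beta>. admissible_choice x \<alpha> \<beta>"
proof -
  have "\<forall>i j. \<exists>a b. (cmod a)\<^sup>2 + (cmod b)\<^sup>2 = 1 \<and> has_root a b (dir_point x i j)"
    using ex_unit_form by blast
  then obtain \<alpha> \<beta> where
    "\<forall>i j. (cmod (\<alpha> i j))\<^sup>2 + (cmod (\<beta> i j))\<^sup>2 = 1 \<and> has_root (\<alpha> i j) (\<beta> i j) (dir_point x i j)"
    by metis
  then show ?thesis unfolding admissible_choice_def by blast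
qed

end

theory Submission
  imports Defs "HOL-Analysis.Cross3" "HOL-Analysis.Simplex_Content"
begin

text \<open>
  The lines joining the midpoints of opposite edges of a semiregular tetrahedron are orthogonal and
  meet in the centroid \<open>g\<close>, so the vertices are \<open>g + u + v + w\<close>, \<open>g + u - v - w\<close>, \<open>g - u + v - w\<close>,
  \<open>g - u - v + w\<close> with \<open>u\<close>, \<open>v\<close>, \<open>w\<close> orthogonal. The determinant of four binary cubics is
  invariant under \<open>SU(2)\<close>, so \<open>u\<close>, \<open>v\<close>, \<open>w\<close> may be rotated to the coordinate axes. The half turns
  about the axes then permute the vertices and act on cubics by reversing coefficients and changing
  signs; up to phases that are controlled explicitly, the four rows are the orbit of one cubic
  \<open>m0 + m1 t + m2 t^2 + m3 t^3\<close>, and the determinant is \<open>4 (m0 m1 - m2 m3)^2\<close>. For edge lengths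
  \<open>a\<close>, \<open>b\<close>, \<open>c\<close> this makes the Atiyah determinant the real number \<open>4 (4 a b c + d3 a b c)^2\<close>.
  Since \<open>288 V^2 = 4 K\<close> with \<open>K\<close> the product of the numbers \<open>b^2 + c^2 - a^2\<close> (cyclically), both
  inequalities follow from \<open>15 a b c d3 + 4 d3^2 \<ge> 19 K\<close>, hence from \<open>K \<le> d3^2\<close> and
  \<open>d3 \<le> a b c\<close>.
\<close>

no_notation Matrix.scalar_prod (infix "\<bullet>" 70)
unbundle cross3_syntax

subsection \<open>Determinants of four binary cubics\<close>

text \<open>Laplace expansion along row 0, with minors again written as \<open>Matrix.mat\<close>,
  so that it can be iterated as a rewrite rule.\<close>

lemma det_mat_Suc:
  fixes f :: "nat \<times> nat \<Rightarrow> 'a :: comm_ring_1"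
  shows "Determinant.det (Matrix.mat (Suc n) (Suc n) f) =
    (\<Sum>j<Suc n. f (0, j) * ((-1) ^ j *
       Determinant.det (Matrix.mat n n (\<lambda>(i, k). f (Suc i, if k < j then k else Suc k)))))"
proof -
  have "Determinant.det (Matrix.mat (Suc n) (Suc n) f) =
     (\<Sum>j<Suc n. Matrix.mat (Suc n) (Suc n) f $$ (0, j) * cofactor (Matrix.mat (Suc n) (Suc n) f) 0 j)"
    by (rule laplace_expansion_row) auto
  also have "\<dots> = (\<Sum>j<Suc n. f (0, j) * ((-1) ^ j *
       Determinant.det (Matrix.mat n n (\<lambda>(i, k). f (Suc i, if k < j then k else Suc k)))))"
  proof (rule sum.cong, rule refl)
    fix j assume "j \<in> {..<Suc n}"
    moreover have "mat_delete (Matrix.mat (Suc n) (Suc n) f) 0 j =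
        Matrix.mat n n (\<lambda>(i, k). f (Suc i, if k < j then k else Suc k))"
      by (rule eq_matI) (auto simp: mat_delete_def)
    ultimately show "Matrix.mat (Suc n) (Suc n) f $$ (0, j) * cofactor (Matrix.mat (Suc n) (Suc n) f) 0 j
        = f (0, j) * ((-1) ^ j *
       Determinant.det (Matrix.mat n n (\<lambda>(i, k). f (Suc i, if k < j then k else Suc k))))"
      by (simp add: Determinant.cofactor_def)
  qed
  finally show ?thesis .
qed

lemma det_mat_4:
  fixes f :: "nat \<times> nat \<Rightarrow> 'a :: comm_ring_1"
  defines "m2 \<equiv> \<lambda>i j. f (2, i) * f (3, j) - f (2, j) * f (3, i)"
  shows "Determinant.det (Matrix.mat 4 4 f) =
      f (0, 0) * (f (1, 1) * m2 2 3 - f (1, 2) * m2 1 3 + f (1, 3) * m2 1 2)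
    - f (0, 1) * (f (1, 0) * m2 2 3 - f (1, 2) * m2 0 3 + f (1, 3) * m2 0 2)
    + f (0, 2) * (f (1, 0) * m2 1 3 - f (1, 1) * m2 0 3 + f (1, 3) * m2 0 1)
    - f (0, 3) * (f (1, 0) * m2 1 2 - f (1, 1) * m2 0 2 + f (1, 2) * m2 0 1)"
  unfolding m2_def by (simp add: eval_nat_numeral det_mat_Suc algebra_simps)

text \<open>A pair \<open>(\<alpha>, \<beta>)\<close> stands for the form \<open>\<alpha> * t + \<beta>\<close>.\<close>

definition form :: "complex \<times> complex \<Rightarrow> complex poly" where
  "form s = [:snd s, fst s:]"

text \<open>If \<open>(cmod g)^2 + (cmod h)^2 = 1\<close>, this applies the matrix of
  \<open>SU(2)\<close> with rows \<open>(g, h)\<close> and \<open>(- cnj h, cnj g)\<close> to the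
  coefficient vector.\<close>

definition act :: "complex \<Rightarrow> complex \<Rightarrow> complex \<times> complex \<Rightarrow> complex \<times> complex" where
  "act g h s = (g * fst s + h * snd s, cnj g * snd s - cnj h * fst s)"

text \<open>The quaternionic structure on linear forms. On roots it is the antipodal map, so it
  takes the form chosen for a pair \<open>i < j\<close> to the form of the reversed pair.\<close>

definition conj_form :: "complex \<times> complex \<Rightarrow> complex \<times> complex" where
  "conj_form s = (- cnj (snd s), cnj (fst s))"

text \<open>\<open>SU(2)\<close> commutes with the quaternionic structure, so rotating the six
  chosen forms also rotates their conjugates.\<close>

lemma conj_form_act: "conj_form (act g h s) = act g h (conj_form s)"
  by (simp add: conj_form_def act_def)

definition coeff_det :: "(nat \<Rightarrow> complex poly) \<Rightarrow> complex" where
  "coeff_det P = Determinant.det (Matrix.mat 4 4 (\<lambda>(i, j). Polynomial.coeff (P i) j))"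

text \<open>The linear map \<open>t \<mapsto> a t + c\<close>, \<open>1 \<mapsto> b t + d\<close> on linear forms, extended to cubics; row \<open>i\<close> is the
  image of \<open>t ^ i\<close>.\<close>

definition cube_matrix :: "complex \<Rightarrow> complex \<Rightarrow> complex \<Rightarrow> complex \<Rightarrow> nat \<times> nat \<Rightarrow> complex" where
  "cube_matrix a b c d = (\<lambda>(i, j). Polynomial.coeff ([:d, b:] ^ (3 - i) * [:c, a:] ^ i) j)"

text \<open>This is a symmetric cube: eigenvalues \<open>x\<close>, \<open>y\<close> of the 2 by 2
  matrix become \<open>x^3\<close>, \<open>x^2 * y\<close>, \<open>x * y^2\<close>,
  \<open>y^3\<close>, with product \<open>(x * y)^6\<close>.\<close>

lemma det_cube_matrix:
  "Determinant.det (Matrix.mat 4 4 (cube_matrix a b c d)) = (a * d - b * c) ^ 6"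
  unfolding det_mat_4 by (simp add: cube_matrix_def eval_nat_numeral, simp add: algebra_simps)

text \<open>Acting on every linear factor multiplies the coefficient matrix on the right by the
  symmetric cube of a matrix of determinant 1.\<close>

lemma coeff_det_act:
  assumes "(cmod g)\<^sup>2 + (cmod h)\<^sup>2 = 1"
  shows "coeff_det (\<lambda>i. form (act g h (r i)) * form (act g h (s i)) * form (act g h (t i))) =
         coeff_det (\<lambda>i. form (r i) * form (s i) * form (t i))"
proof -
  let ?P = "\<lambda>i. form (r i) * form (s i) * form (t i)"
  let ?Q = "\<lambda>i. form (act g h (r i)) * form (act g h (s i)) * form (act g h (t i))"
  let ?C = "Matrix.mat 4 4 (cube_matrix g h (- cnj h) (cnj g))"
  let ?M = "Matrix.mat 4 4 (\<lambda>(i, j). Polynomial.coeff (?P i) j)"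
  have row: "Polynomial.coeff (?Q i) j =
      (\<Sum>k<4. Polynomial.coeff (?P i) k * cube_matrix g h (- cnj h) (cnj g) (k, j))" if "j < 4" for i j
  proof -
    have "j = 0 \<or> j = 1 \<or> j = 2 \<or> j = 3" using that by linarith
    then show ?thesis
      by (elim disjE) (simp_all add: form_def act_def cube_matrix_def eval_nat_numeral algebra_simps)
  qed
  have "Matrix.mat 4 4 (\<lambda>(i, j). Polynomial.coeff (?Q i) j) = ?M * ?C"
    by (rule eq_matI) (simp_all add: row scalar_prod_def atLeast0LessThan)
  then have "coeff_det ?Q = coeff_det ?P * (g * cnj g - h * (- cnj h)) ^ 6"
    unfolding coeff_det_def by (simp add: det_mult[of _ 4] det_cube_matrix)
  also have "g * cnj g - h * (- cnj h) = 1"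
    using assms by (simp flip: complex_norm_square of_real_power of_real_add)
  finally show ?thesis by simp
qed

subsection \<open>Linear forms and rotations of the sphere\<close>

definition unit_form :: "complex \<times> complex \<Rightarrow> bool" where
  "unit_form s \<longleftrightarrow> (cmod (fst s))\<^sup>2 + (cmod (snd s))\<^sup>2 = 1"

text \<open>For a form with \<open>unit_form\<close>, this is the point of the sphere whose stereographic projection is the
  root; unlike the root it is a polynomial in the coefficients and their conjugates.\<close>

definition root_dir :: "complex \<times> complex \<Rightarrow> real^3" where
  "root_dir s = vector [Re (- 2 * cnj (fst s) * snd s), Im (- 2 * cnj (fst s) * snd s),
     (cmod (snd s))\<^sup>2 - (cmod (fst s))\<^sup>2]"

text \<open>The covering of \<open>SO(3)\<close> by \<open>SU(2)\<close>, applied to the element with first row \<open>(g, h)\<close>.\<close>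

definition rot :: "complex \<Rightarrow> complex \<Rightarrow> real^3 \<Rightarrow> real^3" where
  "rot g h n =
     (let N = Complex (n $ 1) (n $ 2); N' = (cnj g)\<^sup>2 * N - (cnj h)\<^sup>2 * cnj N - 2 * cnj g * cnj h * of_real (n $ 3)
      in vector [Re N', Im N', ((cmod g)\<^sup>2 - (cmod h)\<^sup>2) * n $ 3 + 2 * Re (cnj g * h * N)])"

lemma vec3_eq_iff: "(x :: 'a ^ 3) = y \<longleftrightarrow> x $ 1 = y $ 1 \<and> x $ 2 = y $ 2 \<and> x $ 3 = y $ 3"
  by (simp add: Finite_Cartesian_Product.vec_eq_iff forall_3)

lemma norm_vec3: "(norm (x :: real^3))\<^sup>2 = (x $ 1)\<^sup>2 + (x $ 2)\<^sup>2 + (x $ 3)\<^sup>2"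
  unfolding power2_norm_eq_inner by (simp add: inner_vec_def sum_3 power2_eq_square)

text \<open>Equivariance of the Hopf map. Both sides are polynomials in real and imaginary parts, so
  a root at infinity is no special case.\<close>

lemma root_dir_act: "root_dir (act g h s) = rot g h (root_dir s)"
  by (simp add: vec3_eq_iff root_dir_def act_def rot_def Let_def cmod_power2 del: mult_minus_left)
     (simp add: power2_eq_square algebra_simps)

lemma unit_form_act:
  assumes "(cmod g)\<^sup>2 + (cmod h)\<^sup>2 = 1"
  shows "unit_form (act g h s) \<longleftrightarrow> unit_form s"
proof -
  have "(cmod (fst (act g h s)))\<^sup>2 + (cmod (snd (act g h s)))\<^sup>2 =
      ((cmod g)\<^sup>2 + (cmod h)\<^sup>2) * ((cmod (fst s))\<^sup>2 + (cmod (snd s))\<^sup>2)"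
    unfolding cmod_power2 act_def by (simp add: power2_eq_square, simp add: algebra_simps)
  then show ?thesis using assms by (simp add: unit_form_def)
qed

text \<open>\<open>rot\<close> is quadratic in \<open>(g, h)\<close> and scales every length by
  \<open>(cmod g)^2 + (cmod h)^2\<close>.\<close>

lemma orthogonal_rot:
  assumes "(cmod g)\<^sup>2 + (cmod h)\<^sup>2 = 1"
  shows "orthogonal_transformation (rot g h)"
  unfolding orthogonal_transformation
proof
  show "linear (rot g h)"
    by (rule linearI) (simp_all add: rot_def Let_def vec3_eq_iff algebra_simps power2_eq_square)
  have "(norm (rot g h n))\<^sup>2 = ((cmod g)\<^sup>2 + (cmod h)\<^sup>2)\<^sup>2 * (norm n)\<^sup>2" for n
    unfolding norm_vec3 rot_def Let_def cmod_power2 by (simp add: power2_eq_square, simp add: algebra_simps)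
  then show "\<forall>v. norm (rot g h v) = norm v"
    using assms by (simp add: power2_eq_iff_nonneg)
qed

text \<open>Away from the north pole the root is \<open>N / k\<close>, so
  \<open>b = - a * N / k\<close>. The normalization then forces \<open>(cmod a)^2 = k / 2\<close>,
  whence \<open>- 2 * cnj a * b = N\<close>.\<close>

lemma root_dir_root:
  assumes "norm n = 1" "unit_form (a, b)" "has_root a b (stereo n)"
  shows "root_dir (a, b) = n"
proof -
  have n: "(n $ 1)\<^sup>2 + (n $ 2)\<^sup>2 + (n $ 3)\<^sup>2 = 1" using assms(1) norm_vec3[of n] by simp
  have ab: "(cmod a)\<^sup>2 + (cmod b)\<^sup>2 = 1" using assms(2) by (simp add: unit_form_def)
  show ?thesis
  proof (cases "n $ 3 = 1")
    case True
    then have "n $ 1 = 0" "n $ 2 = 0" using n by (simp_all add: sum_power2_eq_zero_iff)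
    moreover have "a = 0" using assms(3) True by (simp add: stereo_def has_root_def)
    ultimately show ?thesis using ab True by (simp add: root_dir_def vec3_eq_iff)
  next
    case False
    define k where "k = 1 - n $ 3"
    define N where "N = Complex (n $ 1) (n $ 2)"
    have k: "k \<noteq> 0" using False by (simp add: k_def)
    have N: "(cmod N)\<^sup>2 = k * (2 - k)"
      using n unfolding N_def k_def cmod_power2 by (simp add: power2_eq_square algebra_simps)
    have b: "b = - a * N / of_real k"
      using assms(3) False by (simp add: stereo_def has_root_def k_def N_def eq_neg_iff_add_eq_0 add.commute)
    have cb: "(cmod b)\<^sup>2 = (cmod a)\<^sup>2 * (2 - k) / k"
    proof -
      have "(cmod b)\<^sup>2 = (cmod a)\<^sup>2 * (cmod N)\<^sup>2 / k\<^sup>2"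
        by (simp add: b norm_mult norm_divide power_mult_distrib power_divide)
      then show ?thesis unfolding N using k by (simp add: power2_eq_square)
    qed
    have ca: "(cmod a)\<^sup>2 = k / 2"
      using ab k unfolding cb by (simp add: field_simps)
    have "- 2 * cnj a * b = 2 * (a * cnj a) * N / of_real k" by (simp add: b)
    also have "a * cnj a = of_real (k / 2)" by (metis ca complex_norm_square)
    also have "2 * of_real (k / 2) * N / of_real k = N" using k by simp
    finally have "- 2 * cnj a * b = N" .
    moreover have "(cmod b)\<^sup>2 - (cmod a)\<^sup>2 = n $ 3" using ab ca unfolding k_def by argo
    ultimately show ?thesis by (simp add: root_dir_def vec3_eq_iff N_def)
  qed
qed

lemma ex_unit_form_root_dir:
  assumes "norm n = 1"
  obtains s where "unit_form s" "root_dir s = n"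
  using ex_unit_form[of "stereo n"] root_dir_root[OF assms] that by (metis fst_conv snd_conv unit_form_def)

text \<open>The fibres of the Hopf map are circles of phases.\<close>

lemma root_dir_eqD:
  assumes "unit_form s" "unit_form t" "root_dir s = root_dir t"
  obtains z where "cmod z = 1" "fst s = z * fst t" "snd s = z * snd t"
proof -
  obtain a b c d where [simp]: "s = (a, b)" "t = (c, d)" by fastforce
  have s: "(cmod a)\<^sup>2 + (cmod b)\<^sup>2 = 1" and t: "(cmod c)\<^sup>2 + (cmod d)\<^sup>2 = 1"
    using assms by (simp_all add: unit_form_def)
  have r: "cnj a * b = cnj c * d" "(cmod b)\<^sup>2 - (cmod a)\<^sup>2 = (cmod d)\<^sup>2 - (cmod c)\<^sup>2"
    using assms(3) by (simp_all add: root_dir_def vec3_eq_iff complex_eq_iff)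
  have n: "(cmod a)\<^sup>2 = (cmod c)\<^sup>2" "(cmod b)\<^sup>2 = (cmod d)\<^sup>2" using s t r by linarith+
  have cc: "a * cnj a = c * cnj c" "b * cnj b = d * cnj d" using n by (metis complex_norm_square)+
  have one: "a * cnj a + b * cnj b = 1" "c * cnj c + d * cnj d = 1"
    using s t by (metis complex_norm_square of_real_1 of_real_add)+
  have r': "a * cnj b = c * cnj d" using arg_cong[OF r(1), of cnj] by simp
  \<comment> \<open>For proportional unit vectors the factor is their Hermitian product.\<close>
  define z where "z = a * cnj c + b * cnj d"
  have "z * c = a * (c * cnj c) + b * (c * cnj d)" by (simp add: z_def algebra_simps)
  also have "\<dots> = a * (a * cnj a + b * cnj b)" by (simp only: cc(1)[symmetric] r'[symmetric]) (simp add: algebra_simps)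
  finally have 1: "z * c = a" by (simp add: one)
  have "z * d = a * (cnj c * d) + b * (d * cnj d)" by (simp add: z_def algebra_simps)
  also have "\<dots> = b * (a * cnj a + b * cnj b)" by (simp only: cc(2)[symmetric] r(1)[symmetric]) (simp add: algebra_simps)
  finally have 2: "z * d = b" by (simp add: one)
  have "(cmod z)\<^sup>2 * ((cmod c)\<^sup>2 + (cmod d)\<^sup>2) = (cmod (z*c))\<^sup>2 + (cmod (z*d))\<^sup>2"
    by (simp add: norm_mult power_mult_distrib algebra_simps)
  then have "(cmod z)\<^sup>2 = 1" using s t by (simp add: 1 2)
  then have "cmod z = 1" by (simp add: power2_eq_1_iff) (smt (verit) norm_ge_zero)
  then show ?thesis using that 1 2 by simp
qed

text \<open>If \<open>s\<close> has root direction \<open>e3\<close>, the element with first row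
  \<open>(snd s, - fst s)\<close> turns \<open>s\<close> into a constant, which moves the root to
  infinity and \<open>e3\<close> to the third axis. A phase \<open>z\<close> on that row preserves
  this and leaves a rotation about the third axis free.\<close>

lemma exists_rot_to_axes:
  assumes "norm e1 = 1" "norm e3 = 1" "e1 \<bullet> e3 = 0"
  obtains g h where "(cmod g)\<^sup>2 + (cmod h)\<^sup>2 = 1"
    "rot g h e1 = axis 1 1" "rot g h e3 = axis 3 1"
proof -
  obtain s where s: "unit_form s" "root_dir s = e3" using ex_unit_form_root_dir assms(2) .
  have u: "(cmod (z * snd s))\<^sup>2 + (cmod (- z * fst s))\<^sup>2 = 1" if "cmod z = 1" for z
    using s that by (simp add: unit_form_def norm_mult add.commute)
  have e3: "rot (z * snd s) (- z * fst s) e3 = axis 3 1" if "cmod z = 1" for z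
  proof -
    have "fst (act (z * snd s) (- z * fst s) s) = 0" by (simp add: act_def)
    moreover have "unit_form (act (z * snd s) (- z * fst s) s)"
      using unit_form_act[OF u[OF that]] s by simp
    ultimately have "root_dir (act (z * snd s) (- z * fst s) s) = axis 3 1"
      by (simp add: root_dir_def unit_form_def vec3_eq_iff axis_def)
    then show ?thesis by (simp add: root_dir_act s)
  qed
  define N where "N = (let n = rot (snd s) (- fst s) e1 in Complex (n $ 1) (n $ 2))"
  \<comment> \<open>The phase \<open>z\<close> multiplies the horizontal part of the image of
    \<open>e1\<close> by \<open>(cnj z)^2\<close>, so a square root of \<open>N\<close> makes it
    1.\<close>
  define z where "z = csqrt N"
  have o: "orthogonal_transformation (rot (snd s) (- fst s))" using u[of 1] orthogonal_rot by simp
  have "rot (snd s) (- fst s) e1 \<bullet> rot (snd s) (- fst s) e3 = 0"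
    using o assms(3) by (simp add: orthogonal_transformation_def)
  then have n3: "rot (snd s) (- fst s) e1 $ 3 = 0" using e3[of 1] by (simp add: inner_axis)
  have "norm (rot (snd s) (- fst s) e1) = 1" using o assms(1) by (simp add: orthogonal_transformation)
  then have "(cmod N)\<^sup>2 = 1" using norm_vec3[of "rot (snd s) (- fst s) e1"] n3 by (simp add: N_def Let_def cmod_power2)
  then have N: "cmod N = 1" by (simp add: power2_eq_1_iff) (smt (verit) norm_ge_zero)
  then have z: "cmod z = 1" by (simp add: z_def)
  have "(cnj z)\<^sup>2 * N = 1"
    using N by (simp add: z_def flip: complex_cnj_power) (metis complex_norm_square mult.commute of_real_1 power_one)
  moreover have "Complex (rot (z * snd s) (- z * fst s) e1 $ 1) (rot (z * snd s) (- z * fst s) e1 $ 2) = (cnj z)\<^sup>2 * N"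
    unfolding N_def rot_def Let_def by (simp add: power2_eq_square algebra_simps complex_eq_iff)
  ultimately have *: "rot (z * snd s) (- z * fst s) e1 $ 1 = 1" "rot (z * snd s) (- z * fst s) e1 $ 2 = 0"
    by (metis complex.sel one_complex.simps)+
  have "norm (rot (z * snd s) (- z * fst s) e1) = 1"
    using orthogonal_rot[OF u[OF z]] assms(1) by (simp add: orthogonal_transformation)
  then have "rot (z * snd s) (- z * fst s) e1 $ 3 = 0"
    using norm_vec3[of "rot (z * snd s) (- z * fst s) e1"] * by simp
  then have "rot (z * snd s) (- z * fst s) e1 = axis 1 1" using * by (simp add: vec3_eq_iff axis_def)
  then show ?thesis using that[OF u[OF z]] e3[OF z] by blast
qed

subsection \<open>The determinant of a semiregular tetrahedron\<close>

text \<open>Apart from the scalars, the sums and differences of rows 0 and 3 and of rows 1 and 2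
  live on columns 1, 3 and 0, 2 respectively. The two resulting blocks have equal determinants,
  hence the square.\<close>

lemma coeff_det_Klein_orbit:
  assumes "P 0 = [:m0, m1, m2, m3:]" "P 1 = Polynomial.smult u [:m3, m2, m1, m0:]"
    "P 2 = Polynomial.smult v [:- m3, m2, - m1, m0:]" "P 3 = Polynomial.smult w [:- m0, m1, - m2, m3:]"
  shows "coeff_det P = 4 * (u * v * w) * (m0 * m1 - m2 * m3)\<^sup>2"
  unfolding coeff_det_def det_mat_4 prod.case assms
  by (simp add: eval_nat_numeral, simp add: algebra_simps)

lemma cmod_1_cnj: "cmod z = 1 \<Longrightarrow> cnj z * z = 1"
  by (metis complex_norm_square mult.commute of_real_1 power_one)

lemma cnj_mult_of_root_dir:
  "cnj (fst s) * snd s = - Complex (root_dir s $ 1) (root_dir s $ 2) / 2"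
  by (simp add: root_dir_def complex_eq_iff field_simps)

lemma unit_formD:
  assumes "unit_form s"
  shows "cnj (fst s) * fst s = of_real ((1 - root_dir s $ 3) / 2)"
    "cnj (snd s) * snd s = of_real ((1 + root_dir s $ 3) / 2)"
proof -
  have "(cmod (fst s))\<^sup>2 = (1 - root_dir s $ 3) / 2" "(cmod (snd s))\<^sup>2 = (1 + root_dir s $ 3) / 2"
    using assms by (simp_all add: unit_form_def root_dir_def)
  then show "cnj (fst s) * fst s = of_real ((1 - root_dir s $ 3) / 2)"
    "cnj (snd s) * snd s = of_real ((1 + root_dir s $ 3) / 2)"
    by (metis complex_norm_square mult.commute)+
qed

text \<open>The imaginary part of the left side is \<open>(s * y * n - x * t * m) / 4\<close>, which
  the assumption makes zero. This is why the determinant comes out real.\<close>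

lemma phase_sum:
  fixes x y s t m n :: real
  assumes "x * t * m = s * y * n"
  shows "(\<i> * of_real (x / 2)) * (of_real ((1 - t) / 2) * Complex (m / 2) (n / 2)
        - of_real ((1 + t) / 2) * Complex (m / 2) (- n / 2))
    - of_real (s / 2) * (of_real ((1 - y) / 2) * Complex (m / 2) (n / 2)
        + of_real ((1 + y) / 2) * Complex (m / 2) (- n / 2))
    + of_real (1 / 2) * (- of_real ((1 - y) / 2) * of_real ((1 - t) / 2) - of_real ((1 + y) / 2) * of_real ((1 + t) / 2))
    = - of_real ((1 + s * m + x * n + y * t) / 4)"
  using assms by (simp add: complex_eq_iff field_simps)

text \<open>\<open>a\<close>, \<open>b\<close>, \<open>c\<close> are the forms of the edges at the
  first vertex, \<open>a'\<close>, \<open>b'\<close>, \<open>c'\<close> those of the opposite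
  edges.\<close>

lemma coeff_det_axes:
  assumes u: "unit_form a" "unit_form b" "unit_form c" "unit_form a'" "unit_form b'" "unit_form c'"
    and a: "root_dir a = vector [0, - q / A, - r / A]" "root_dir a' = vector [0, - q / A, r / A]"
    and b: "root_dir b = vector [- p / B, 0, - r / B]" "root_dir b' = vector [- p / B, 0, r / B]"
    and c: "root_dir c = vector [- p / C, - q / C, 0]" "root_dir c' = vector [- p / C, q / C, 0]"
    and nz: "A \<noteq> 0" "B \<noteq> 0" "C \<noteq> 0"
    and P: "P 0 = form a * form b * form c"
      "P 1 = form (conj_form a) * form c' * form b'"
      "P 2 = form (conj_form b) * form (conj_form c') * form a'"
      "P 3 = form (conj_form c) * form (conj_form b') * form (conj_form a')"
  shows "coeff_det P = of_real ((1 + p\<^sup>2 / (B * C) + q\<^sup>2 / (A * C) + r\<^sup>2 / (A * B))\<^sup>2 / 4)"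
proof -
  obtain a1 a0 b1 b0 c1 c0 where abc: "a = (a1, a0)" "b = (b1, b0)" "c = (c1, c0)" by fastforce
  \<comment> \<open>Half turns about the axes map the six edge directions to each other, so each of the forms
    is, up to a phase, obtained from \<open>a\<close>, \<open>b\<close> or \<open>c\<close> by swapping coefficients and signs.\<close>
  obtain z1 where z1: "cmod z1 = 1" "a' = (z1 * a0, z1 * - a1)"
    by (rule root_dir_eqD[of a' "(a0, - a1)"]; cases a')
      (use u(1,4) a in \<open>simp_all add: abc unit_form_def root_dir_def vec3_eq_iff algebra_simps\<close>)
  obtain z2 where z2: "cmod z2 = 1" "b' = (z2 * b0, z2 * b1)"
    by (rule root_dir_eqD[of b' "(b0, b1)"]; cases b')
      (use u b in \<open>simp_all add: abc unit_form_def root_dir_def vec3_eq_iff algebra_simps\<close>)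
  obtain z3 where z3: "cmod z3 = 1" "c' = (z3 * c0, z3 * c1)"
    by (rule root_dir_eqD[of c' "(c0, c1)"]; cases c')
      (use u c in \<open>simp_all add: abc unit_form_def root_dir_def vec3_eq_iff algebra_simps\<close>)
  obtain z4 where z4: "cmod z4 = 1" "- cnj a0 = z4 * a0" "cnj a1 = z4 * a1"
    by (rule root_dir_eqD[of "conj_form a" "(a0, a1)"])
      (use u a in \<open>simp_all add: abc unit_form_def root_dir_def vec3_eq_iff conj_form_def algebra_simps\<close>)
  obtain z5 where z5: "cmod z5 = 1" "- cnj b0 = z5 * b0" "cnj b1 = z5 * - b1"
    by (rule root_dir_eqD[of "conj_form b" "(b0, - b1)"])
      (use u b in \<open>simp_all add: abc unit_form_def root_dir_def vec3_eq_iff conj_form_def algebra_simps\<close>)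
  obtain z6 where z6: "cmod z6 = 1" "- cnj c0 = z6 * c1" "cnj c1 = z6 * - c0"
    by (rule root_dir_eqD[of "conj_form c" "(c1, - c0)"])
      (use u c in \<open>simp_all add: abc unit_form_def root_dir_def vec3_eq_iff conj_form_def algebra_simps\<close>)
  have cn: "cnj a0 = - z4 * a0" "cnj a1 = z4 * a1" "cnj b0 = - z5 * b0" "cnj b1 = - z5 * b1"
    "cnj c0 = - z6 * c1" "cnj c1 = - z6 * c0"
    using z4 z5 z6 by (simp_all add: minus_equation_iff[of "cnj _"])
  define m0 where "m0 = a0 * b0 * c0"
  define m1 where "m1 = a1 * b0 * c0 + a0 * b1 * c0 + a0 * b0 * c1"
  define m2 where "m2 = a0 * b1 * c1 + a1 * b0 * c1 + a1 * b1 * c0"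
  define m3 where "m3 = a1 * b1 * c1"
  note m = m0_def m1_def m2_def m3_def
  have "coeff_det P = 4 * ((z4 * z3 * z2) * (z5 * (cnj z3 * z6) * z1) * (z6 * (cnj z2 * z5) * (cnj z1 * z4)))
      * (m0 * m1 - m2 * m3)\<^sup>2"
  proof (rule coeff_det_Klein_orbit)
    show "P 0 = [:m0, m1, m2, m3:]"
      unfolding P by (simp add: form_def abc m algebra_simps)
    show "P 1 = Polynomial.smult (z4 * z3 * z2) [:m3, m2, m1, m0:]"
      unfolding P by (simp add: form_def abc conj_form_def cn z3 z2 m algebra_simps)
    show "P 2 = Polynomial.smult (z5 * (cnj z3 * z6) * z1) [:- m3, m2, - m1, m0:]"
      unfolding P by (simp add: form_def abc conj_form_def cn z3 z1 m algebra_simps)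
    show "P 3 = Polynomial.smult (z6 * (cnj z2 * z5) * (cnj z1 * z4)) [:- m0, m1, - m2, m3:]"
      unfolding P by (simp add: form_def abc conj_form_def cn z2 z1 m algebra_simps)
  qed
  \<comment> \<open>An edge contributes a factor at both of its ends, once conjugated, so
    \<open>z1\<close>, \<open>z2\<close>, \<open>z3\<close> cancel. The phases \<open>z4\<close>,
    \<open>z5\<close>, \<open>z6\<close> occur twice each and go into the square.\<close>
  also have "\<dots> = 4 * ((cnj z1 * z1) * (cnj z2 * z2) * (cnj z3 * z3)) * (z4 * z5 * z6 * (m0 * m1 - m2 * m3))\<^sup>2"
    by (simp add: power2_eq_square mult_ac)
  also have "\<dots> = 4 * (z4 * z5 * z6 * (m0 * m1 - m2 * m3))\<^sup>2"
    by (simp add: cmod_1_cnj z1 z2 z3)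
  \<comment> \<open>The phases are just enough to leave only products of one coefficient with a
    conjugated coefficient of the same form, and \<open>root_dir\<close> determines these.\<close>
  also have "z4 * z5 * z6 * (m0 * m1 - m2 * m3) =
      (cnj a1 * a0) * ((cnj b0 * b0) * (cnj c1 * c0) - (cnj b1 * b1) * (cnj c0 * c1))
    - (cnj b1 * b0) * ((cnj a0 * a0) * (cnj c1 * c0) + (cnj a1 * a1) * (cnj c0 * c1))
    + (cnj c1 * c1) * (- (cnj a0 * a0) * (cnj b0 * b0) - (cnj a1 * a1) * (cnj b1 * b1))"
    unfolding m cn by (simp add: algebra_simps)
  also have "\<dots> = - of_real ((1 + p\<^sup>2 / (B * C) + q\<^sup>2 / (A * C) + r\<^sup>2 / (A * B)) / 4)"
  proof -
    have va: "cnj a1 * a1 = of_real ((1 + r / A) / 2)" "cnj a0 * a0 = of_real ((1 - r / A) / 2)"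
      "cnj a1 * a0 = \<i> * of_real (q / A / 2)"
      using unit_formD[OF u(1), unfolded a] cnj_mult_of_root_dir[of a, unfolded a]
      by (simp_all add: abc(1) complex_eq_iff)
    have vb: "cnj b1 * b1 = of_real ((1 + r / B) / 2)" "cnj b0 * b0 = of_real ((1 - r / B) / 2)"
      "cnj b1 * b0 = of_real (p / B / 2)"
      using unit_formD[OF u(2), unfolded b] cnj_mult_of_root_dir[of b, unfolded b]
      by (simp_all add: abc(2) complex_eq_iff)
    have vc: "cnj c1 * c1 = of_real (1 / 2)" "cnj c1 * c0 = Complex (p / C / 2) (q / C / 2)"
      using unit_formD[OF u(3), unfolded c] cnj_mult_of_root_dir[of c, unfolded c]
      by (simp_all add: abc(3) complex_eq_iff)
    have vc': "cnj c0 * c1 = Complex (p / C / 2) (- q / C / 2)"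
      using arg_cong[OF vc(2), of cnj] by (simp add: mult.commute complex_eq_iff)
    have "q / A * (r / B) * (p / C) = p / B * (r / A) * (q / C)" by (simp add: mult_ac)
    moreover have "1 + p\<^sup>2 / (B * C) + q\<^sup>2 / (A * C) + r\<^sup>2 / (A * B) =
        1 + p / B * (p / C) + q / A * (q / C) + r / A * (r / B)"
      by (simp add: power2_eq_square)
    ultimately show ?thesis
      unfolding va vb vc vc' using phase_sum[of "q / A" "r / B" "p / C" "p / B" "r / A" "q / C"]
      by (simp only: minus_divide_left)
  qed
  finally show ?thesis by (simp add: power_divide power2_eq_square)
qed

lemma coeff_det_cong: "(\<And>i. i < 4 \<Longrightarrow> P i = Q i) \<Longrightarrow> coeff_det P = coeff_det Q"
  unfolding coeff_det_def by (intro arg_cong[where f = Determinant.det] eq_matI) auto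

text \<open>The case \<open>u = 0\<close> occurs when the tetrahedron flattens to a rectangle; the
  cross product then supplies the missing direction.\<close>

lemma unit_multiple_orthogonal:
  fixes u v w :: "real^3"
  assumes "v \<noteq> 0" "w \<noteq> 0" "u \<bullet> v = 0" "u \<bullet> w = 0" "v \<bullet> w = 0"
  obtains e where "norm e = 1" "u = norm u *\<^sub>R e" "e \<bullet> v = 0" "e \<bullet> w = 0"
proof (cases "u = 0")
  case True
  have "(norm (v \<times> w))\<^sup>2 = (norm v * norm w)\<^sup>2" using norm_cross_dot[of v w] assms(5) by simp
  then have "v \<times> w \<noteq> 0" using assms(1,2) by auto
  then show ?thesis
    using True that[of "(v \<times> w) /\<^sub>R norm (v \<times> w)"] by (simp add: dot_cross_self inner_commute)
next
  case False
  then show ?thesis using assms that[of "u /\<^sub>R norm u"] by simp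
qed

text \<open>At most one of the three vectors vanishes, so unit vectors \<open>e1\<close>,
  \<open>e3\<close> along \<open>u\<close>, \<open>w\<close> can be chosen orthogonal to each other
  and to \<open>v\<close>. Once they are on the axes, orthogonality puts \<open>v\<close> on the
  second axis.\<close>

lemma exists_rot_orthogonal_to_axes:
  fixes u v w :: "real^3"
  assumes o: "u \<bullet> v = 0" "u \<bullet> w = 0" "v \<bullet> w = 0"
    and nz: "v + w \<noteq> 0" "u + w \<noteq> 0" "u + v \<noteq> 0"
  obtains g h p q r where "(cmod g)\<^sup>2 + (cmod h)\<^sup>2 = 1"
    "rot g h u = vector [p, 0, 0]" "rot g h v = vector [0, q, 0]" "rot g h w = vector [0, 0, r]"
proof -
  have "\<exists>e1 e3. norm e1 = 1 \<and> norm e3 = 1 \<and> e1 \<bullet> e3 = 0 \<and> v \<bullet> e1 = 0 \<and> v \<bullet> e3 = 0 \<and>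
      u = norm u *\<^sub>R e1 \<and> w = norm w *\<^sub>R e3"
  proof -
    have unit: "norm (y /\<^sub>R norm y) = 1" "y = norm y *\<^sub>R (y /\<^sub>R norm y)" if "y \<noteq> 0" for y :: "real^3"
      using that by simp_all
    show ?thesis
    proof (cases "u = 0")
      case True
      then have "v \<noteq> 0" "w \<noteq> 0" using nz by auto
      then obtain e where "norm e = 1" "u = norm u *\<^sub>R e" "e \<bullet> v = 0" "e \<bullet> w = 0"
        using unit_multiple_orthogonal o by metis
      then show ?thesis using unit[OF \<open>w \<noteq> 0\<close>] o
        by (intro exI[of _ e] exI[of _ "w /\<^sub>R norm w"]) (simp add: inner_commute)
    next
      case u: False
      show ?thesis
      proof (cases "w = 0")
        case True
        then have "v \<noteq> 0" using nz by auto
        then obtain e where "norm e = 1" "w = norm w *\<^sub>R e" "e \<bullet> v = 0" "e \<bullet> u = 0"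
          using unit_multiple_orthogonal[of v u w] o u by (metis inner_commute)
        then show ?thesis using unit[OF u] o
          by (intro exI[of _ "u /\<^sub>R norm u"] exI[of _ e]) (simp add: inner_commute)
      next
        case False
        then show ?thesis using unit[OF u] unit[OF False] o
          by (intro exI[of _ "u /\<^sub>R norm u"] exI[of _ "w /\<^sub>R norm w"]) (simp add: inner_commute)
      qed
    qed
  qed
  then obtain e1 e3 where e: "norm e1 = 1" "norm e3 = 1" "e1 \<bullet> e3 = 0" "v \<bullet> e1 = 0" "v \<bullet> e3 = 0"
      and uw: "u = norm u *\<^sub>R e1" "w = norm w *\<^sub>R e3" by blast
  obtain g h where gh: "(cmod g)\<^sup>2 + (cmod h)\<^sup>2 = 1" and R: "rot g h e1 = axis 1 1" "rot g h e3 = axis 3 1"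
    using exists_rot_to_axes e by metis
  have orth: "orthogonal_transformation (rot g h)" by (rule orthogonal_rot[OF gh])
  have "rot g h v \<bullet> axis 1 1 = 0" "rot g h v \<bullet> axis 3 1 = 0"
    using orth e(4,5) unfolding R[symmetric] by (simp_all add: orthogonal_transformation_def)
  then have v: "rot g h v = vector [0, rot g h v $ 2, 0]" by (simp add: vec3_eq_iff inner_axis)
  have "rot g h u = norm u *\<^sub>R axis 1 1" "rot g h w = norm w *\<^sub>R axis 3 1"
    using uw R orthogonal_transformation_scaleR[OF orth] by metis+
  then have "rot g h u = vector [norm u, 0, 0]" "rot g h w = vector [0, 0, norm w]"
    by (simp_all add: vec3_eq_iff axis_def)
  then show ?thesis using that gh v by blast
qed

text \<open>By invariance the forms may be rotated until \<open>coeff_det_axes\<close> applies; the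
  rotation preserves norms, so \<open>p\<close>, \<open>q\<close>, \<open>r\<close> can be
  eliminated from the result.\<close>

lemma coeff_det_semiregular:
  fixes u v w :: "real^3"
  defines "A \<equiv> norm (v + w)" and "B \<equiv> norm (u + w)" and "C \<equiv> norm (u + v)"
  assumes o: "u \<bullet> v = 0" "u \<bullet> w = 0" "v \<bullet> w = 0"
    and nz: "v + w \<noteq> 0" "u + w \<noteq> 0" "u + v \<noteq> 0"
    and unit: "unit_form a" "unit_form b" "unit_form c" "unit_form a'" "unit_form b'" "unit_form c'"
    and a: "root_dir a = (- v - w) /\<^sub>R A" "root_dir a' = (w - v) /\<^sub>R A"
    and b: "root_dir b = (- u - w) /\<^sub>R B" "root_dir b' = (w - u) /\<^sub>R B"
    and c: "root_dir c = (- u - v) /\<^sub>R C" "root_dir c' = (v - u) /\<^sub>R C"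
    and P: "P 0 = form a * form b * form c"
      "P 1 = form (conj_form a) * form c' * form b'"
      "P 2 = form (conj_form b) * form (conj_form c') * form a'"
      "P 3 = form (conj_form c) * form (conj_form b') * form (conj_form a')"
  shows "coeff_det P = of_real ((1 + (norm u)\<^sup>2 / (B * C) + (norm v)\<^sup>2 / (A * C) + (norm w)\<^sup>2 / (A * B))\<^sup>2 / 4)"
proof -
  obtain g h p q r where gh: "(cmod g)\<^sup>2 + (cmod h)\<^sup>2 = 1"
    and R: "rot g h u = vector [p, 0, 0]" "rot g h v = vector [0, q, 0]" "rot g h w = vector [0, 0, r]"
    using exists_rot_orthogonal_to_axes[OF o nz] .
  have orth: "orthogonal_transformation (rot g h)" by (rule orthogonal_rot[OF gh])
  note lin = orthogonal_transformation_linear[OF orth]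
  have n: "(norm u)\<^sup>2 = p\<^sup>2" "(norm v)\<^sup>2 = q\<^sup>2" "(norm w)\<^sup>2 = r\<^sup>2"
    using norm_vec3[of "rot g h u"] norm_vec3[of "rot g h v"] norm_vec3[of "rot g h w"]
    by (simp_all add: R) (use orth R in \<open>metis orthogonal_transformation\<close>)+
  \<comment> \<open>The factors of the rows as functions of the row index, the shape that
    \<open>coeff_det_act\<close> expects.\<close>
  define l where "l = (\<lambda>i. [a, conj_form a, conj_form b, conj_form c] ! i)"
  define m where "m = (\<lambda>i. [b, c', conj_form c', conj_form b'] ! i)"
  define k where "k = (\<lambda>i. [c, b', a', conj_form a'] ! i)"
  have "coeff_det P = coeff_det (\<lambda>i. form (l i) * form (m i) * form (k i))"
  proof (rule coeff_det_cong)
    fix i :: nat assume "i < 4"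
    then have "i = 0 \<or> i = 1 \<or> i = 2 \<or> i = 3" by linarith
    then show "P i = form (l i) * form (m i) * form (k i)"
      by (elim disjE; hypsubst) (unfold P l_def m_def k_def, simp_all)
  qed
  also have "\<dots> = coeff_det (\<lambda>i. form (act g h (l i)) * form (act g h (m i)) * form (act g h (k i)))"
    by (rule coeff_det_act[OF gh, symmetric])
  also have "\<dots> = of_real ((1 + p\<^sup>2 / (B * C) + q\<^sup>2 / (A * C) + r\<^sup>2 / (A * B))\<^sup>2 / 4)"
  proof (rule coeff_det_axes[of "act g h a" "act g h b" "act g h c" "act g h a'" "act g h b'" "act g h c'"])
    note rots = root_dir_act linear_scale[OF lin] linear_diff[OF lin] linear_neg[OF lin] R
    show "root_dir (act g h a) = vector [0, - q / A, - r / A]"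
      "root_dir (act g h a') = vector [0, - q / A, r / A]"
      unfolding a rots by (simp_all add: vec3_eq_iff divide_inverse)
    show "root_dir (act g h b) = vector [- p / B, 0, - r / B]"
      "root_dir (act g h b') = vector [- p / B, 0, r / B]"
      unfolding b rots by (simp_all add: vec3_eq_iff divide_inverse)
    show "root_dir (act g h c) = vector [- p / C, - q / C, 0]"
      "root_dir (act g h c') = vector [- p / C, q / C, 0]"
      unfolding c rots by (simp_all add: vec3_eq_iff divide_inverse)
    show "A \<noteq> 0" "B \<noteq> 0" "C \<noteq> 0" using nz by (simp_all add: A_def B_def C_def)
  qed (simp_all add: unit_form_act[OF gh] unit l_def m_def k_def conj_form_act)
  finally show ?thesis by (simp only: n)
qed

subsection \<open>Volume and the inequality for acute triangles\<close>

lemma content_tetrahedron: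
  fixes x0 x1 x2 x3 :: "real^3"
  assumes "distinct [x0, x1, x2, x3]"
  shows "measure lborel (convex hull {x0, x1, x2, x3}) =
    \<bar>Determinants.det (\<chi> i j. (if j = 1 then x1 else if j = 2 then x2 else x3) $ i - x0 $ i)\<bar> / 6"
proof -
  let ?f = "\<lambda>j :: 3. if j = 1 then x1 else if j = 2 then x2 else x3"
  have "(UNIV :: 3 set) = {1, 2, 3}" using exhaust_3 by auto
  moreover have "bij_betw ?f {1, 2, 3} {x1, x2, x3}"
    unfolding bij_betw_def using assms by (simp add: insert_commute)
  ultimately have "bij_betw ?f UNIV {x1, x2, x3}" by simp
  also have "{x1, x2, x3} = {x0, x1, x2, x3} - {x0}" using assms by auto
  finally have "bij_betw ?f UNIV ({x0, x1, x2, x3} - {x0})" .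
  with assms show ?thesis
    using content_simplex[of "{x0, x1, x2, x3}" x0 ?f] by (simp add: eval_nat_numeral)
qed

text \<open>\<open>D\<close> is the triple product of \<open>u\<close>, \<open>v\<close>,
  \<open>w\<close>, and its square is their Gram determinant. The edges at the first vertex are
  minus twice \<open>v + w\<close>, \<open>u + w\<close>, \<open>u + v\<close>, with determinant
  \<open>- 16 * D\<close>.\<close>

lemma content_orthogonal_tetrahedron:
  fixes u v w g :: "real^3"
  assumes o: "u \<bullet> v = 0" "u \<bullet> w = 0" "v \<bullet> w = 0"
    and d: "distinct [g + u + v + w, g + u - v - w, g - u + v - w, g - u - v + w]"
  shows "288 * (measure lborel (convex hull {g + u + v + w, g + u - v - w, g - u + v - w, g - u - v + w}))\<^sup>2 =
    2048 * (norm u)\<^sup>2 * (norm v)\<^sup>2 * (norm w)\<^sup>2"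
proof -
  define D where "D = u $ 1 * (v $ 2 * w $ 3 - v $ 3 * w $ 2) - u $ 2 * (v $ 1 * w $ 3 - v $ 3 * w $ 1)
    + u $ 3 * (v $ 1 * w $ 2 - v $ 2 * w $ 1)"
  have "D\<^sup>2 = (u \<bullet> u) * (v \<bullet> v) * (w \<bullet> w) + 2 * (u \<bullet> v) * (v \<bullet> w) * (u \<bullet> w)
     - (u \<bullet> u) * (v \<bullet> w)\<^sup>2 - (v \<bullet> v) * (u \<bullet> w)\<^sup>2 - (w \<bullet> w) * (u \<bullet> v)\<^sup>2"
    unfolding D_def inner_vec_def sum_3 by (simp add: power2_eq_square algebra_simps)
  then have D: "D\<^sup>2 = (norm u)\<^sup>2 * (norm v)\<^sup>2 * (norm w)\<^sup>2"
    using o by (simp add: power2_norm_eq_inner)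
  let ?x0 = "g + u + v + w" and ?x1 = "g + u - v - w" and ?x2 = "g - u + v - w" and ?x3 = "g - u - v + w"
  have "Determinants.det (\<chi> i j. (if j = 1 then ?x1 else if j = 2 then ?x2 else ?x3) $ i - ?x0 $ i) = - 16 * D"
    unfolding Determinants.det_3 D_def by (simp add: algebra_simps)
  then have "measure lborel (convex hull {?x0, ?x1, ?x2, ?x3}) = \<bar>- 16 * D\<bar> / 6"
    by (simp only: content_tetrahedron[OF d])
  then have "(measure lborel (convex hull {?x0, ?x1, ?x2, ?x3}))\<^sup>2 = (- 16 * D)\<^sup>2 / 6\<^sup>2"
    by (simp only: power_divide power2_abs)
  then show ?thesis by (simp add: power_mult_distrib D)
qed

text \<open>The square of \<open>d3 a b c\<close> is \<open>S * T * U\<close>. The second bound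
  comes from \<open>S <= a^2\<close> and its cyclic versions, the third from multiplying
  \<open>Y * Z <= S^2\<close> and its cyclic versions and taking a square root.\<close>

lemma d3_bounds:
  assumes pos: "a > 0" "b > 0" "c > 0"
    and acute: "a\<^sup>2 \<le> b\<^sup>2 + c\<^sup>2" "b\<^sup>2 \<le> c\<^sup>2 + a\<^sup>2" "c\<^sup>2 \<le> a\<^sup>2 + b\<^sup>2"
  shows "0 \<le> d3 a b c" "d3 a b c \<le> a * b * c"
    "(b\<^sup>2 + c\<^sup>2 - a\<^sup>2) * (c\<^sup>2 + a\<^sup>2 - b\<^sup>2) * (a\<^sup>2 + b\<^sup>2 - c\<^sup>2) \<le> (d3 a b c)\<^sup>2"
proof -
  have tri: "z \<le> x + y" if "x > 0" "y > 0" "z\<^sup>2 \<le> x\<^sup>2 + y\<^sup>2" for x y z :: real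
  proof (rule power2_le_imp_le)
    have "x * y > 0" using that by simp
    then show "z\<^sup>2 \<le> (x + y)\<^sup>2" using that unfolding power2_sum by linarith
  qed (use that in simp)
  \<comment> \<open>Each of these is the product of two of the three factors of
    \<open>d3 a b c\<close>.\<close>
  define S T U where "S = a\<^sup>2 - (b - c)\<^sup>2" and "T = b\<^sup>2 - (c - a)\<^sup>2" and "U = c\<^sup>2 - (a - b)\<^sup>2"
  define X Y Z where "X = b\<^sup>2 + c\<^sup>2 - a\<^sup>2" and "Y = c\<^sup>2 + a\<^sup>2 - b\<^sup>2" and "Z = a\<^sup>2 + b\<^sup>2 - c\<^sup>2"
  have XYZ: "0 \<le> X" "0 \<le> Y" "0 \<le> Z" using acute by (simp_all add: X_def Y_def Z_def)
  have f: "a + b - c \<ge> 0" "b + c - a \<ge> 0" "c + a - b \<ge> 0"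
    using tri[of a b c] tri[of b c a] tri[of c a b] pos acute by simp_all
  show d: "0 \<le> d3 a b c" using f by (simp add: d3_def)
  have STU: "S = (a + b - c) * (c + a - b)" "T = (b + c - a) * (a + b - c)" "U = (c + a - b) * (b + c - a)"
    by (simp_all add: S_def T_def U_def power2_eq_square algebra_simps)
  then have nn: "0 \<le> S" "0 \<le> T" "0 \<le> U" using f by simp_all
  have sq: "(d3 a b c)\<^sup>2 = S * T * U" by (simp add: STU d3_def power2_eq_square)
  have "S * T * U \<le> a\<^sup>2 * b\<^sup>2 * c\<^sup>2"
    by (intro mult_mono nn mult_nonneg_nonneg) (simp_all add: S_def T_def U_def)
  then have "(d3 a b c)\<^sup>2 \<le> (a * b * c)\<^sup>2" by (simp add: sq power_mult_distrib)
  then show "d3 a b c \<le> a * b * c" by (rule power2_le_imp_le) (use pos in simp)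
  have "S\<^sup>2 - Y * Z = 2 * (b - c)\<^sup>2 * X" "T\<^sup>2 - Z * X = 2 * (c - a)\<^sup>2 * Y" "U\<^sup>2 - X * Y = 2 * (a - b)\<^sup>2 * Z"
    by (simp_all add: S_def T_def U_def X_def Y_def Z_def power2_eq_square algebra_simps)
  moreover have "0 \<le> 2 * (b - c)\<^sup>2 * X" "0 \<le> 2 * (c - a)\<^sup>2 * Y" "0 \<le> 2 * (a - b)\<^sup>2 * Z"
    using XYZ by simp_all
  ultimately have le: "Y * Z \<le> S\<^sup>2" "Z * X \<le> T\<^sup>2" "X * Y \<le> U\<^sup>2" by linarith+
  have "(Y * Z) * (Z * X) * (X * Y) \<le> S\<^sup>2 * T\<^sup>2 * U\<^sup>2"
    by (intro mult_mono le mult_nonneg_nonneg XYZ) simp_all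
  then have "(X * Y * Z)\<^sup>2 \<le> (S * T * U)\<^sup>2" by (simp add: power2_eq_square mult_ac)
  then have "X * Y * Z \<le> S * T * U" by (rule power2_le_imp_le) (use nn in simp)
  then show "(b\<^sup>2 + c\<^sup>2 - a\<^sup>2) * (c\<^sup>2 + a\<^sup>2 - b\<^sup>2) * (a\<^sup>2 + b\<^sup>2 - c\<^sup>2) \<le> (d3 a b c)\<^sup>2"
    by (simp add: sq X_def Y_def Z_def)
qed

subsection \<open>The Four Points inequalities\<close>

lemma lin_form_less: "i < j \<Longrightarrow> lin_form \<alpha> \<beta> i j = form (\<alpha> i j, \<beta> i j)"
  by (simp add: lin_form_def form_def)

lemma lin_form_greater: "j < i \<Longrightarrow> lin_form \<alpha> \<beta> i j = form (conj_form (\<alpha> j i, \<beta> j i))"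
  by (simp add: lin_form_def form_def conj_form_def)

lemma atiyah_poly_forms:
  fixes \<alpha> \<beta> :: "nat \<Rightarrow> nat \<Rightarrow> complex"
  defines "s \<equiv> \<lambda>i j. (\<alpha> i j, \<beta> i j)"
  shows "atiyah_poly \<alpha> \<beta> 1 = form (s 1 2) * form (s 1 3) * form (s 1 4)"
    "atiyah_poly \<alpha> \<beta> 2 = form (conj_form (s 1 2)) * form (s 2 3) * form (s 2 4)"
    "atiyah_poly \<alpha> \<beta> 3 = form (conj_form (s 1 3)) * form (conj_form (s 2 3)) * form (s 3 4)"
    "atiyah_poly \<alpha> \<beta> 4 = form (conj_form (s 1 4)) * form (conj_form (s 2 4)) * form (conj_form (s 3 4))"
proof -
  have sets: "{1..4} - {1} = {2, 3, 4 :: nat}" "{1..4} - {2} = {1, 3, 4 :: nat}"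
    "{1..4} - {3} = {1, 2, 4 :: nat}" "{1..4} - {4} = {1, 2, 3 :: nat}"
    by auto
  show "atiyah_poly \<alpha> \<beta> 1 = form (s 1 2) * form (s 1 3) * form (s 1 4)"
    "atiyah_poly \<alpha> \<beta> 2 = form (conj_form (s 1 2)) * form (s 2 3) * form (s 2 4)"
    "atiyah_poly \<alpha> \<beta> 3 = form (conj_form (s 1 3)) * form (conj_form (s 2 3)) * form (s 3 4)"
    "atiyah_poly \<alpha> \<beta> 4 = form (conj_form (s 1 4)) * form (conj_form (s 2 4)) * form (conj_form (s 3 4))"
    unfolding atiyah_poly_def sets s_def
    by (simp_all add: lin_form_less lin_form_greater mult.assoc del: One_nat_def)
qed

lemma edge_prod_eq:
  "edge_prod x = dist (x 1) (x 2) * dist (x 1) (x 3) * dist (x 1) (x 4) *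
     dist (x 2) (x 3) * dist (x 2) (x 4) * dist (x 3) (x 4)"
proof -
  have "{(i, j). 1 \<le> i \<and> i < j \<and> j \<le> 4} = {(1, 2), (1, 3), (1, 4), (2, 3), (2, 4), (3, 4 :: nat)}"
    by (auto; presburger)
  then show ?thesis unfolding edge_prod_def by (simp add: mult.assoc del: One_nat_def)
qed

lemma sum_1_4: "(\<Sum>l = 1..4. f l) = f 1 + f 2 + f 3 + f (4 :: nat)" for f :: "nat \<Rightarrow> real"
  by (simp add: eval_nat_numeral)

lemma orthogonal_of_norm_add_eq_norm_diff:
  fixes v w :: "real^3"
  assumes "norm (v + w) = norm (v - w)"
  shows "v \<bullet> w = 0"
  using assms unfolding norm_eq by (simp add: inner_simps inner_commute)

lemma norm_add_orthogonal:
  fixes v w :: "real^3"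
  assumes "v \<bullet> w = 0"
  shows "(norm (v + w))\<^sup>2 = (norm v)\<^sup>2 + (norm w)\<^sup>2"
  using assms unfolding power2_norm_eq_inner by (simp add: inner_simps inner_commute)

lemma distinct_of_inj_on_1_4:
  assumes "inj_on x {1..4 :: nat}"
  shows "distinct [x 1, x 2, x 3, x 4]"
proof -
  have "{1..4} = {1, 2, 3, 4 :: nat}" by auto
  then show ?thesis using assms by (simp del: One_nat_def)
qed

text \<open>Opposite edges are twice the sum and twice the difference of two of \<open>u\<close>,
  \<open>v\<close>, \<open>w\<close>, the diagonals of a parallelogram; equal diagonals make it a
  rectangle.\<close>

lemma semiregularE:
  assumes "semiregular x" "inj_on x {1..4}"
  obtains g u v w where "x 1 = g + u + v + w" "x 2 = g + u - v - w" "x 3 = g - u + v - w" "x 4 = g - u - v + w"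
    "u \<bullet> v = 0" "u \<bullet> w = 0" "v \<bullet> w = 0" "v + w \<noteq> 0" "u + w \<noteq> 0" "u + v \<noteq> 0"
    "dist (x 1) (x 2) = 2 * norm (v + w)" "dist (x 1) (x 3) = 2 * norm (u + w)" "dist (x 1) (x 4) = 2 * norm (u + v)"
    "dist (x 3) (x 4) = 2 * norm (v + w)" "dist (x 2) (x 4) = 2 * norm (u + w)" "dist (x 2) (x 3) = 2 * norm (u + v)"
proof -
  \<comment> \<open>\<open>u\<close>, \<open>v\<close>, \<open>w\<close> lead from the centroid to
    the midpoints of the edges from \<open>x 1\<close> to \<open>x 2\<close>, \<open>x 3\<close>,
    \<open>x 4\<close>.\<close>
  define g u v w where "g = (1/4) *\<^sub>R (x 1 + x 2 + x 3 + x 4)" and "u = (1/4) *\<^sub>R (x 1 + x 2 - x 3 - x 4)"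
    and "v = (1/4) *\<^sub>R (x 1 - x 2 + x 3 - x 4)" and "w = (1/4) *\<^sub>R (x 1 - x 2 - x 3 + x 4)"
  note defs = g_def u_def v_def w_def
  have x: "x 1 = g + u + v + w" "x 2 = g + u - v - w" "x 3 = g - u + v - w" "x 4 = g - u - v + w"
    unfolding defs by (simp_all add: vec3_eq_iff algebra_simps del: One_nat_def)
  have diff: "x 1 - x 2 = 2 *\<^sub>R (v + w)" "x 1 - x 3 = 2 *\<^sub>R (u + w)" "x 1 - x 4 = 2 *\<^sub>R (u + v)"
    "x 3 - x 4 = 2 *\<^sub>R (v - w)" "x 2 - x 4 = 2 *\<^sub>R (u - w)" "x 2 - x 3 = 2 *\<^sub>R (u - v)"
    unfolding x by (simp_all add: vec3_eq_iff)
  have d: "dist (x 1) (x 2) = 2 * norm (v + w)" "dist (x 1) (x 3) = 2 * norm (u + w)"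
    "dist (x 1) (x 4) = 2 * norm (u + v)" "dist (x 3) (x 4) = 2 * norm (v - w)"
    "dist (x 2) (x 4) = 2 * norm (u - w)" "dist (x 2) (x 3) = 2 * norm (u - v)"
    unfolding dist_norm diff by simp_all
  have n: "norm (v + w) = norm (v - w)" "norm (u + w) = norm (u - w)" "norm (u + v) = norm (u - v)"
    using assms(1) d unfolding semiregular_def by simp_all
  have "x 1 \<noteq> x 2" "x 1 \<noteq> x 3" "x 1 \<noteq> x 4"
    using distinct_of_inj_on_1_4[OF assms(2)] by auto
  then have "v + w \<noteq> 0" "u + w \<noteq> 0" "u + v \<noteq> 0"
    using diff(1,2,3) by auto
  then show ?thesis
    using that[of g u v w] x d n orthogonal_of_norm_add_eq_norm_diff by metis
qed

text \<open>An admissible choice enters the computation of the determinant only through these two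
  properties.\<close>

lemma admissible_root_dir:
  assumes "admissible_choice x \<alpha> \<beta>" "x i \<noteq> x j" "1 \<le> i" "i < j" "j \<le> 4"
  shows "unit_form (\<alpha> i j, \<beta> i j)" "root_dir (\<alpha> i j, \<beta> i j) = (x j - x i) /\<^sub>R dist (x i) (x j)"
proof -
  have *: "(cmod (\<alpha> i j))\<^sup>2 + (cmod (\<beta> i j))\<^sup>2 = 1" "has_root (\<alpha> i j) (\<beta> i j) (dir_point x i j)"
    using assms unfolding admissible_choice_def by auto
  then show u: "unit_form (\<alpha> i j, \<beta> i j)" by (simp add: unit_form_def)
  show "root_dir (\<alpha> i j, \<beta> i j) = (x j - x i) /\<^sub>R dist (x i) (x j)"
    by (rule root_dir_root[OF _ u]) (use * assms in \<open>simp_all add: dir_point_def dist_norm norm_minus_commute\<close>)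
qed

lemma atiyah_det_semiregular:
  assumes "inj_on x {1..4}" "semiregular x" "admissible_choice x \<alpha> \<beta>"
  defines "a \<equiv> dist (x 1) (x 2)" and "b \<equiv> dist (x 1) (x 3)" and "c \<equiv> dist (x 1) (x 4)"
  shows "atiyah_det x \<alpha> \<beta> = of_real (4 * (4 * (a * b * c) + d3 a b c)\<^sup>2)"
proof -
  obtain g u v w where x: "x 1 = g + u + v + w" "x 2 = g + u - v - w" "x 3 = g - u + v - w" "x 4 = g - u - v + w"
    and o: "u \<bullet> v = 0" "u \<bullet> w = 0" "v \<bullet> w = 0" and nz: "v + w \<noteq> 0" "u + w \<noteq> 0" "u + v \<noteq> 0"
    and d: "dist (x 1) (x 2) = 2 * norm (v + w)" "dist (x 1) (x 3) = 2 * norm (u + w)" "dist (x 1) (x 4) = 2 * norm (u + v)"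
    "dist (x 3) (x 4) = 2 * norm (v + w)" "dist (x 2) (x 4) = 2 * norm (u + w)" "dist (x 2) (x 3) = 2 * norm (u + v)"
    using semiregularE[OF assms(2,1)] .
  define s where "s = (\<lambda>i j. (\<alpha> i j, \<beta> i j))"
  define A B C where "A = norm (v + w)" and "B = norm (u + w)" and "C = norm (u + v)"
  note ABC = A_def B_def C_def
  have pos: "A > 0" "B > 0" "C > 0" using nz by (simp_all add: ABC)
  have ne: "x i \<noteq> x j" if "1 \<le> i" "i < j" "j \<le> 4" for i j
    using inj_onD[OF assms(1), of i j] that by auto
  have unit: "unit_form (s i j)" if "1 \<le> i" "i < j" "j \<le> 4" for i j
    using admissible_root_dir[OF assms(3) ne] that by (simp add: s_def)
  have dir: "root_dir (s i j) = (x j - x i) /\<^sub>R dist (x i) (x j)" if "1 \<le> i" "i < j" "j \<le> 4" for i j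
    using admissible_root_dir[OF assms(3) ne] that by (simp add: s_def)
  have "coeff_det (\<lambda>i. atiyah_poly \<alpha> \<beta> (i + 1)) =
      of_real ((1 + (norm u)\<^sup>2 / (B * C) + (norm v)\<^sup>2 / (A * C) + (norm w)\<^sup>2 / (A * B))\<^sup>2 / 4)"
    unfolding ABC
  proof (rule coeff_det_semiregular[OF o nz, of "s 1 2" "s 1 3" "s 1 4" "s 3 4" "s 2 4" "s 2 3"])
    show "root_dir (s 1 2) = (- v - w) /\<^sub>R norm (v + w)" "root_dir (s 3 4) = (w - v) /\<^sub>R norm (v + w)"
      "root_dir (s 1 3) = (- u - w) /\<^sub>R norm (u + w)" "root_dir (s 2 4) = (w - u) /\<^sub>R norm (u + w)"
      "root_dir (s 1 4) = (- u - v) /\<^sub>R norm (u + v)" "root_dir (s 2 3) = (v - u) /\<^sub>R norm (u + v)"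
      by (simp_all add: dir d del: One_nat_def; simp add: x vec3_eq_iff field_simps del: One_nat_def)+
    have "(0::nat) + 1 = 1" "(1::nat) + 1 = 2" "(2::nat) + 1 = 3" "(3::nat) + 1 = 4" by simp_all
    note P = atiyah_poly_forms[of \<alpha> \<beta>, folded s_def] this
    show "atiyah_poly \<alpha> \<beta> (0 + 1) = form (s 1 2) * form (s 1 3) * form (s 1 4)"
      "atiyah_poly \<alpha> \<beta> (1 + 1) = form (conj_form (s 1 2)) * form (s 2 3) * form (s 2 4)"
      "atiyah_poly \<alpha> \<beta> (2 + 1) = form (conj_form (s 1 3)) * form (conj_form (s 2 3)) * form (s 3 4)"
      "atiyah_poly \<alpha> \<beta> (3 + 1) = form (conj_form (s 1 4)) * form (conj_form (s 2 4)) * form (conj_form (s 3 4))"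
      by (simp_all only: P s_def)
  qed (simp_all add: unit del: One_nat_def)
  moreover have "atiyah_det x \<alpha> \<beta> = 64 * of_real (edge_prod x) * coeff_det (\<lambda>i. atiyah_poly \<alpha> \<beta> (i + 1))"
    by (simp add: atiyah_det_def coeff_det_def)
  moreover have "edge_prod x = 64 * (A * B * C)\<^sup>2"
    unfolding edge_prod_eq d ABC by (simp add: power2_eq_square)
  ultimately have "atiyah_det x \<alpha> \<beta> = of_real (64 * (64 * (A * B * C)\<^sup>2) *
      ((1 + (norm u)\<^sup>2 / (B * C) + (norm v)\<^sup>2 / (A * C) + (norm w)\<^sup>2 / (A * B))\<^sup>2 / 4))"
    by (simp only: of_real_mult of_real_numeral)
  also have "64 * (64 * (A * B * C)\<^sup>2) *
      ((1 + (norm u)\<^sup>2 / (B * C) + (norm v)\<^sup>2 / (A * C) + (norm w)\<^sup>2 / (A * B))\<^sup>2 / 4) =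
      4 * (16 * (A * B * C * (1 + (norm u)\<^sup>2 / (B * C) + (norm v)\<^sup>2 / (A * C) + (norm w)\<^sup>2 / (A * B))))\<^sup>2"
    by (simp add: power_mult_distrib)
  also have "16 * (A * B * C * (1 + (norm u)\<^sup>2 / (B * C) + (norm v)\<^sup>2 / (A * C) + (norm w)\<^sup>2 / (A * B))) =
      16 * (A * B * C + (norm u)\<^sup>2 * A + (norm v)\<^sup>2 * B + (norm w)\<^sup>2 * C)"
    using pos by (simp add: field_simps)
  also have "\<dots> = 4 * (a * b * c) + d3 a b c"
  proof -
    have "A\<^sup>2 = (norm v)\<^sup>2 + (norm w)\<^sup>2" "B\<^sup>2 = (norm u)\<^sup>2 + (norm w)\<^sup>2" "C\<^sup>2 = (norm u)\<^sup>2 + (norm v)\<^sup>2"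
      using o by (simp_all add: ABC norm_add_orthogonal)
    then have sq: "(norm u)\<^sup>2 = (B\<^sup>2 + C\<^sup>2 - A\<^sup>2) / 2" "(norm v)\<^sup>2 = (A\<^sup>2 + C\<^sup>2 - B\<^sup>2) / 2"
      "(norm w)\<^sup>2 = (A\<^sup>2 + B\<^sup>2 - C\<^sup>2) / 2" by simp_all
    have abc: "a = 2 * A" "b = 2 * B" "c = 2 * C" unfolding a_def b_def c_def d ABC by (rule refl)+
    \<comment> \<open>The identity behind this is that \<open>d3 a b c + 2 * a * b * c\<close> is
      the cyclic sum of \<open>a * (b^2 + c^2 - a^2)\<close>.\<close>
    show ?thesis unfolding sq abc d3_def by (simp add: power2_eq_square field_simps)
  qed
  finally show ?thesis .
qed

text \<open>The difference \<open>b^2 + c^2 - a^2\<close> is \<open>8 * (norm u)^2\<close>, and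
  cyclically, so no face is obtuse and the product of the three gives the volume.\<close>

lemma volume_semiregular:
  assumes "inj_on x {1..4}" "semiregular x"
  defines "a \<equiv> dist (x 1) (x 2)" and "b \<equiv> dist (x 1) (x 3)" and "c \<equiv> dist (x 1) (x 4)"
  shows "288 * (tetra_volume x)\<^sup>2 = 4 * ((b\<^sup>2 + c\<^sup>2 - a\<^sup>2) * (c\<^sup>2 + a\<^sup>2 - b\<^sup>2) * (a\<^sup>2 + b\<^sup>2 - c\<^sup>2))"
    "a\<^sup>2 \<le> b\<^sup>2 + c\<^sup>2" "b\<^sup>2 \<le> c\<^sup>2 + a\<^sup>2" "c\<^sup>2 \<le> a\<^sup>2 + b\<^sup>2"
proof -
  obtain g u v w where x: "x 1 = g + u + v + w" "x 2 = g + u - v - w" "x 3 = g - u + v - w" "x 4 = g - u - v + w"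
    and o: "u \<bullet> v = 0" "u \<bullet> w = 0" "v \<bullet> w = 0"
    and d: "dist (x 1) (x 2) = 2 * norm (v + w)" "dist (x 1) (x 3) = 2 * norm (u + w)" "dist (x 1) (x 4) = 2 * norm (u + v)"
    using semiregularE[OF assms(2,1)] .
  have sq: "a\<^sup>2 = 4 * ((norm v)\<^sup>2 + (norm w)\<^sup>2)" "b\<^sup>2 = 4 * ((norm u)\<^sup>2 + (norm w)\<^sup>2)"
      "c\<^sup>2 = 4 * ((norm u)\<^sup>2 + (norm v)\<^sup>2)"
    using o unfolding a_def b_def c_def d
    by (simp_all add: power_mult_distrib norm_add_orthogonal)
  then show "a\<^sup>2 \<le> b\<^sup>2 + c\<^sup>2" "b\<^sup>2 \<le> c\<^sup>2 + a\<^sup>2" "c\<^sup>2 \<le> a\<^sup>2 + b\<^sup>2" by simp_all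
  have "{1..4} = {1, 2, 3, 4 :: nat}" by auto
  then have "x ` {1..4} = {x 1, x 2, x 3, x 4}" by simp
  moreover have "distinct [x 1, x 2, x 3, x 4]"
    by (rule distinct_of_inj_on_1_4[OF assms(1)])
  ultimately have "288 * (tetra_volume x)\<^sup>2 = 2048 * (norm u)\<^sup>2 * (norm v)\<^sup>2 * (norm w)\<^sup>2"
    unfolding tetra_volume_def x using content_orthogonal_tetrahedron[OF o] by simp
  then show "288 * (tetra_volume x)\<^sup>2 = 4 * ((b\<^sup>2 + c\<^sup>2 - a\<^sup>2) * (c\<^sup>2 + a\<^sup>2 - b\<^sup>2) * (a\<^sup>2 + b\<^sup>2 - c\<^sup>2))"
    by (simp add: sq)
qed

theorem mainTheorem6:
  fixes x :: "nat \<Rightarrow> real^3" and \<alpha> \<beta> :: "nat \<Rightarrow> nat \<Rightarrow> complex"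
  assumes "inj_on x {1..4}"
    and "semiregular x"
    and "admissible_choice x \<alpha> \<beta>"
  shows "four_points_inequality x (atiyah_det x \<alpha> \<beta>) (weak_delta x) \<and>
         four_points_inequality x (atiyah_det x \<alpha> \<beta>) (\<lambda>l. 1)"
proof -
  define a b c where "a = dist (x 1) (x 2)" and "b = dist (x 1) (x 3)" and "c = dist (x 1) (x 4)"
  have d: "dist (x 1) (x 2) = a" "dist (x 1) (x 3) = b" "dist (x 1) (x 4) = c"
    "dist (x 3) (x 4) = a" "dist (x 2) (x 4) = b" "dist (x 2) (x 3) = c"
    using assms(2) unfolding semiregular_def a_def b_def c_def by simp_all
  have d': "dist (x 2) (x 1) = a" "dist (x 3) (x 1) = b" "dist (x 4) (x 1) = c"
    "dist (x 4) (x 3) = a" "dist (x 4) (x 2) = b" "dist (x 3) (x 2) = c"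
    using d by (metis dist_commute)+
  have ne: "x 1 \<noteq> x 2" "x 1 \<noteq> x 3" "x 1 \<noteq> x 4"
    using distinct_of_inj_on_1_4[OF assms(1)] by auto
  then have pos: "a > 0" "b > 0" "c > 0" by (simp_all add: a_def b_def c_def)
  note vol = volume_semiregular[OF assms(1,2), folded a_def b_def c_def]
  note bounds = d3_bounds[OF pos vol(2,3,4)]
  note faces = face_d3_def face_prod_def vertex_prod_def opposite_face prod.case d d'
  \<comment> \<open>All four faces are congruent with sides \<open>a\<close>, \<open>b\<close>,
    \<open>c\<close>, and these are also the lengths of the edges at each vertex.\<close>
  have face: "face_d3 x l = d3 a b c" "face_prod x l = a * b * c" "vertex_prod x l = a * b * c"
    if "l \<in> {1, 2, 3, 4}" for l
    using that by (elim insertE emptyE; hypsubst; unfold faces; simp add: d3_def mult_ac add.commute)+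
  let ?M = "a * b * c" and ?d = "d3 a b c"
  define K where "K = (b\<^sup>2 + c\<^sup>2 - a\<^sup>2) * (c\<^sup>2 + a\<^sup>2 - b\<^sup>2) * (a\<^sup>2 + b\<^sup>2 - c\<^sup>2)"
  have M: "?M > 0" using pos by simp
  \<comment> \<open>The right-hand side grows with \<delta> because \<open>d3 a b c\<close> is
    nonnegative, so a bound by 1 on \<delta> covers the weak and the strong version
    together.\<close>
  have main: "four_points_inequality x (atiyah_det x \<alpha> \<beta>) \<delta>"
    if \<delta>: "\<And>l. l \<in> {1, 2, 3, 4} \<Longrightarrow> \<delta> l \<le> 1" for \<delta>
  proof -
    have le: "(4 + 1/4 * \<delta> l) * vertex_prod x l * face_d3 x l \<le> 17/4 * (?M * ?d)" if "l \<in> {1, 2, 3, 4}" for l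
    proof -
      have "(4 + 1/4 * \<delta> l) * (?M * ?d) \<le> 17/4 * (?M * ?d)"
        using \<delta>[OF that] M bounds(1) by (intro mult_right_mono) simp_all
      then show ?thesis by (simp add: face[OF that] mult.assoc)
    qed
    define S where "S = (\<Sum>l = 1..4. (4 + 1/4 * \<delta> l) * vertex_prod x l * face_d3 x l)"
    have S: "S \<le> 17 * (?M * ?d)"
      unfolding S_def sum_1_4 using le[of 1] le[of 2] le[of 3] le[of 4] by simp
    have edges: "edge_prod x = ?M\<^sup>2" unfolding edge_prod_eq d by (simp add: power2_eq_square)
    have det: "Re (atiyah_det x \<alpha> \<beta>) = 64 * ?M\<^sup>2 + 32 * (?M * ?d) + 4 * ?d\<^sup>2"
      unfolding atiyah_det_semiregular[OF assms, folded a_def b_def c_def] Re_complex_of_real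
      by (simp add: power2_eq_square algebra_simps)
    have volume: "288 * (tetra_volume x)\<^sup>2 = 4 * K" unfolding K_def by (rule vol(1))
    have K: "K \<le> ?d\<^sup>2" unfolding K_def by (rule bounds(3))
    have "?d\<^sup>2 \<le> ?M * ?d"
      unfolding power2_eq_square using bounds(1,2) by (rule mult_right_mono[rotated])
    with S K show ?thesis
      unfolding four_points_inequality_def S_def[symmetric] edges det volume by simp
  qed
  have "weak_delta x l \<le> 1" if "l \<in> {1, 2, 3, 4}" for l
    unfolding weak_delta_def face[OF that] using bounds(2) M by simp
  then show ?thesis using main by simp
qed

end
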